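(* Let $\mathcal{D}[t]\hookrightarrow\mathcal{H}\hookrightarrow\mathcal{D}^\times[t^\times]$ be a rigged Hilbert space with $\mathcal{D}[t]$ reflexive, let $(X,\mu)$ be a measure space with $\mu$ a $\sigma$-finite positive measure, and let $\omega: x\in X\mapsto\omega_x\in\mathcal{D}^\times$ be a $\mu$-independent Bessel distribution map. Furthermore, suppose that for every $h\in L^2(X,\mu)$ there exists a bounded subset $\mathcal{M}\subset\mathcal{D}$ such that $$\left|\int_X h(x)\langle\omega_x|g\rangle\,d\mu\right|\le\sup_{f\in\mathcal{M}}|\langle f|g\rangle|,\quad\forall g\in\mathcal{D}.$$ If $\theta: x\in X\mapsto\theta_x\in\mathcal{D}^\times$ is a dual map of $\omega$, then $\theta$ is a Riesz-Fischer distribution map.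
   Context: A rigged Hilbert space $\mathcal{D}[t]\hookrightarrow\mathcal{H}\hookrightarrow\mathcal{D}^\times[t^\times]$ consists of a Hilbert space $\mathcal{H}$, a dense subspace $\mathcal{D}$ of $\mathcal{H}$ endowed with a locally convex topology $t$ finer than the topology induced by the Hilbert norm, and the conjugate dual $\mathcal{D}^\times$ of $\mathcal{D}[t]$ (the space of continuous conjugate linear functionals on $\mathcal{D}[t]$) with the strong dual topology $t^\times$, defined by the seminorms $q_{\mathcal{M}}(F)=\sup_{g\in\mathcal{M}}|\langle F|g\rangle|$, $\mathcal{M}$ a bounded subset of $\mathcal{D}[t]$; the arrows denote continuous injections with dense range, and $\mathcal{H}$ is identified with a subspace of $\mathcal{D}^\times$, so that the sesquilinear form $\langle\cdot|\cdot\rangle$ putting $\mathcal{D}$ and $\mathcal{D}^\times$ in duality extends the inner product of $\mathcal{H}$ (linear in the first variable). For $F\in\mathcal{D}^\times$ and $f\in\mathcal{D}$, $\langle F|f\rangle$ denotes the value of $F$ at $f$, and $\langle f|F\rangle:=\overline{\langle F|f\rangle}$. Bounded subsets of $\mathcal{D}$ are meant with respect to the topology $t$. A map $\omega: X\to\mathcal{D}^\times$, $x\mapsto\omega_x$, is weakly measurable if for every $f\in\mathcal{D}$ the complex valued function $x\mapsto\langle f|\omega_x\rangle$ is $\mu$-measurable. A weakly measurable map $\omega$ is: - $\mu$-independent if the unique measurable function $\xi$ on $(X,\mu)$ such that $\int_X\xi(x)\langle g|\omega_x\rangle\,d\mu=0$ for every $g\in\mathcal{D}$ is $\xi(x)=0$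 $\mu$-a.e.; - a Bessel distribution map (Bessel map) if $\int_X|\langle f|\omega_x\rangle|^2\,d\mu<\infty$ for every $f\in\mathcal{D}$; - a Riesz-Fischer distribution map (Riesz-Fischer map) if for every $h\in L^2(X,\mu)$ there exists $f\in\mathcal{D}$ such that $\langle f|\omega_x\rangle=h(x)$ for $\mu$-a.e. $x\in X$. A dual map of a weakly measurable map $\omega$ is a weakly measurable map $\theta: X\to\mathcal{D}^\times$ such that for all $f,g\in\mathcal{D}$ the integral $\int_X\langle f|\theta_x\rangle\langle\omega_x|g\rangle\,d\mu$ exists with $\left|\int_X\langle f|\theta_x\rangle\langle\omega_x|g\rangle\,d\mu\right|<\infty$, and $\langle f|g\rangle=\int_X\langle f|\theta_x\rangle\langle\omega_x|g\rangle\,d\mu$. *)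

theory Defs
  imports "HOL-Analysis.Analysis" "HOL-Library.Function_Algebras"
begin

section \<open>Complex Hilbert spaces\<close>

text \<open>The Banach space structure (norm, topology, completeness, real scalars) is that of the type;
  the locale adds the complex scalars and an inner product inducing the norm, linear in its first
  argument. Positive definiteness is contained in \<open>cinner_self\<close>.\<close>

locale complex_hilbert_space = vector_space scaleC
  for scaleC :: "complex \<Rightarrow> 'h::banach \<Rightarrow> 'h" +
  fixes cinner :: "'h \<Rightarrow> 'h \<Rightarrow> complex"
  assumes scaleC_of_real: "scaleC (complex_of_real r) x = r *\<^sub>R x"
    and cinner_add_left: "cinner (x + y) z = cinner x z + cinner y z"
    and cinner_scaleC_left: "cinner (scaleC c x) y = c * cinner x y"
    and cinner_commute: "cinner x y = cnj (cinner y x)"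
    and cinner_self: "cinner x x = complex_of_real ((norm x)\<^sup>2)"


section \<open>Topological vector spaces, conjugate duals, reflexivity\<close>

text \<open>A topological vector space is given by a scalar multiplication \<open>s\<close> on the ambient type and an
  abstract topology \<open>T\<close>; the underlying space is the subspace \<open>topspace T\<close>.\<close>

definition locally_convex_tvs ::
  "(complex \<Rightarrow> 'v::real_vector \<Rightarrow> 'v) \<Rightarrow> 'v topology \<Rightarrow> bool" where
  "locally_convex_tvs s T \<longleftrightarrow>
     module.subspace s (topspace T) \<and>
     continuous_map (prod_topology T T) T (\<lambda>(x, y). x + y) \<and>
     continuous_map (prod_topology euclidean T) T (\<lambda>(c, x). s c x) \<and>
     (\<forall>U. openin T U \<and> 0 \<in> U \<longrightarrow> (\<exists>V. openin T V \<and> 0 \<in> V \<and> V \<subseteq> U \<and> convex V))"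

definition tvs_bounded ::
  "(complex \<Rightarrow> 'v::ab_group_add \<Rightarrow> 'v) \<Rightarrow> 'v topology \<Rightarrow> 'v set \<Rightarrow> bool" where
  "tvs_bounded s T B \<longleftrightarrow>
     B \<subseteq> topspace T \<and>
     (\<forall>U. openin T U \<and> 0 \<in> U \<longrightarrow> (\<exists>r>0. \<forall>c. r \<le> cmod c \<longrightarrow> B \<subseteq> s c ` U))"

definition conj_linear_on ::
  "(complex \<Rightarrow> 'v::ab_group_add \<Rightarrow> 'v) \<Rightarrow> 'v set \<Rightarrow> ('v \<Rightarrow> complex) \<Rightarrow> bool" where
  "conj_linear_on s V F \<longleftrightarrow>
     (\<forall>x\<in>V. \<forall>y\<in>V. F (x + y) = F x + F y) \<and>
     (\<forall>c. \<forall>x\<in>V. F (s c x) = cnj c * F x)"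

text \<open>A functional on \<open>topspace T\<close> is represented by the function on the whole type that vanishes
  outside \<open>topspace T\<close>, so that equality of functionals is equality of functions and the conjugate
  dual is a vector space under the pointwise operations.\<close>

definition conj_dual ::
  "(complex \<Rightarrow> 'v::ab_group_add \<Rightarrow> 'v) \<Rightarrow> 'v topology \<Rightarrow> ('v \<Rightarrow> complex) set" where
  "conj_dual s T =
     {F. conj_linear_on s (topspace T) F \<and> continuous_map T euclidean F \<and>
         (\<forall>x. x \<notin> topspace T \<longrightarrow> F x = 0)}"

definition fun_scale :: "complex \<Rightarrow> ('v \<Rightarrow> complex) \<Rightarrow> 'v \<Rightarrow> complex" where
  "fun_scale c F = (\<lambda>x. c * F x)"

text \<open>Suprema are taken in the extended nonnegative reals, where the supremum over the empty set
  is \<open>0\<close>.\<close>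

definition dual_seminorm :: "'v set \<Rightarrow> ('v \<Rightarrow> complex) \<Rightarrow> ennreal" where
  "dual_seminorm B F = (SUP g\<in>B. ennreal (cmod (F g)))"

definition strong_dual_topology ::
  "(complex \<Rightarrow> 'v::ab_group_add \<Rightarrow> 'v) \<Rightarrow> 'v topology \<Rightarrow> ('v \<Rightarrow> complex) topology" where
  "strong_dual_topology s T =
     topology_generated_by
       {{G \<in> conj_dual s T. dual_seminorm B (G - F) < ennreal e} | F B e.
          F \<in> conj_dual s T \<and> tvs_bounded s T B \<and> 0 < e}"

text \<open>The canonical map into the conjugate bidual sends \<open>f\<close> to the functional
  \<open>F \<mapsto> \<langle>f|F\<rangle> = cnj (F f)\<close>, which is conjugate linear in \<open>F\<close>. The map itself is
  linear, so being a homeomorphism makes it an isomorphism of topological vector spaces.\<close>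

definition canonical_bidual_map ::
  "(complex \<Rightarrow> 'v::ab_group_add \<Rightarrow> 'v) \<Rightarrow> 'v topology \<Rightarrow> 'v \<Rightarrow> ('v \<Rightarrow> complex) \<Rightarrow> complex" where
  "canonical_bidual_map s T f = (\<lambda>F. if F \<in> conj_dual s T then cnj (F f) else 0)"

definition reflexive_tvs ::
  "(complex \<Rightarrow> 'v::ab_group_add \<Rightarrow> 'v) \<Rightarrow> 'v topology \<Rightarrow> bool" where
  "reflexive_tvs s T \<longleftrightarrow>
     homeomorphic_map T (strong_dual_topology fun_scale (strong_dual_topology s T))
       (canonical_bidual_map s T)"


section \<open>Rigged Hilbert spaces\<close>

definition hilbert_to_dual :: "('h \<Rightarrow> 'h \<Rightarrow> complex) \<Rightarrow> 'h set \<Rightarrow> 'h \<Rightarrow> 'h \<Rightarrow> complex" where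
  "hilbert_to_dual cinner D h = (\<lambda>f. if f \<in> D then cinner h f else 0)"

locale rigged_hilbert_space = complex_hilbert_space scaleC cinner
  for scaleC :: "complex \<Rightarrow> 'h::banach \<Rightarrow> 'h"
    and cinner :: "'h \<Rightarrow> 'h \<Rightarrow> complex" +
  fixes D :: "'h set" and t :: "'h topology"
  assumes topspace_t: "topspace t = D"
    and D_dense: "closure D = UNIV"
    and locally_convex_t: "locally_convex_tvs scaleC t"
    and t_finer: "\<And>U. openin (top_of_set D) U \<Longrightarrow> openin t U"
    and hilbert_to_dual_inj: "inj (hilbert_to_dual cinner D)"
    and hilbert_to_dual_continuous:
      "continuous_map euclidean (strong_dual_topology scaleC t) (hilbert_to_dual cinner D)"
    and hilbert_to_dual_dense:
      "strong_dual_topology scaleC t closure_of range (hilbert_to_dual cinner D)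
         = conj_dual scaleC t"


section \<open>Distribution maps\<close>

text \<open>For \<open>F\<close> in the conjugate dual and \<open>f\<close> in \<open>D = topspace t\<close>, the value \<open>\<langle>F|f\<rangle>\<close> is \<open>F f\<close>, and
  \<open>\<langle>f|F\<rangle>\<close> is \<open>cnj (F f)\<close>.\<close>

definition square_integrable :: "'x measure \<Rightarrow> ('x \<Rightarrow> complex) set" where
  "square_integrable M = {h \<in> borel_measurable M. integrable M (\<lambda>x. (cmod (h x))\<^sup>2)}"

definition weakly_measurable_map ::
  "(complex \<Rightarrow> 'h::ab_group_add \<Rightarrow> 'h) \<Rightarrow> 'h topology \<Rightarrow> 'x measure \<Rightarrow> ('x \<Rightarrow> 'h \<Rightarrow> complex) \<Rightarrow> bool"
  where
  "weakly_measurable_map s t M \<omega> \<longleftrightarrow>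
     \<omega> \<in> space M \<rightarrow> conj_dual s t \<and>
     (\<forall>f\<in>topspace t. (\<lambda>x. cnj (\<omega> x f)) \<in> borel_measurable M)"

text \<open>A vanishing integral presupposes integrability, which the total Bochner integral would not
  enforce; hence \<open>has_bochner_integral\<close>.\<close>

definition mu_independent_map ::
  "(complex \<Rightarrow> 'h::ab_group_add \<Rightarrow> 'h) \<Rightarrow> 'h topology \<Rightarrow> 'x measure \<Rightarrow> ('x \<Rightarrow> 'h \<Rightarrow> complex) \<Rightarrow> bool"
  where
  "mu_independent_map s t M \<omega> \<longleftrightarrow>
     weakly_measurable_map s t M \<omega> \<and>
     (\<forall>\<xi> \<in> borel_measurable M.
        (\<forall>g\<in>topspace t. has_bochner_integral M (\<lambda>x. \<xi> x * cnj (\<omega> x g)) 0) \<longrightarrow>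
        (AE x in M. \<xi> x = 0))"

definition bessel_map ::
  "(complex \<Rightarrow> 'h::ab_group_add \<Rightarrow> 'h) \<Rightarrow> 'h topology \<Rightarrow> 'x measure \<Rightarrow> ('x \<Rightarrow> 'h \<Rightarrow> complex) \<Rightarrow> bool"
  where
  "bessel_map s t M \<omega> \<longleftrightarrow>
     weakly_measurable_map s t M \<omega> \<and>
     (\<forall>f\<in>topspace t. (\<integral>\<^sup>+ x. ennreal ((cmod (cnj (\<omega> x f)))\<^sup>2) \<partial>M) < \<infinity>)"

definition riesz_fischer_map ::
  "(complex \<Rightarrow> 'h::ab_group_add \<Rightarrow> 'h) \<Rightarrow> 'h topology \<Rightarrow> 'x measure \<Rightarrow> ('x \<Rightarrow> 'h \<Rightarrow> complex) \<Rightarrow> bool"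
  where
  "riesz_fischer_map s t M \<omega> \<longleftrightarrow>
     weakly_measurable_map s t M \<omega> \<and>
     (\<forall>h \<in> square_integrable M. \<exists>f\<in>topspace t. AE x in M. cnj (\<omega> x f) = h x)"

definition dual_map ::
  "(complex \<Rightarrow> 'h::ab_group_add \<Rightarrow> 'h) \<Rightarrow> ('h \<Rightarrow> 'h \<Rightarrow> complex) \<Rightarrow> 'h topology \<Rightarrow> 'x measure \<Rightarrow>
     ('x \<Rightarrow> 'h \<Rightarrow> complex) \<Rightarrow> ('x \<Rightarrow> 'h \<Rightarrow> complex) \<Rightarrow> bool"
  where
  "dual_map s cinner t M \<omega> \<theta> \<longleftrightarrow>
     weakly_measurable_map s t M \<theta> \<and>
     (\<forall>f\<in>topspace t. \<forall>g\<in>topspace t.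
        integrable M (\<lambda>x. cnj (\<theta> x f) * \<omega> x g) \<and>
        cinner f g = (LINT x|M. cnj (\<theta> x f) * \<omega> x g))"

end

theory Submission
  imports Defs
begin

text \<open>For \<open>h \<in> L\<^sup>2\<close> the conjugate linear functional \<open>g \<mapsto> \<integral> h \<langle>\<omega>\<^sub>x|g\<rangle> d\<mu>\<close> on \<open>D\<close> is dominated by a
  seminorm of the strong dual topology. As \<open>D\<close> is dense in the conjugate dual, the functional extends to
  a continuous one on the conjugate dual, and reflexivity represents it as \<open>g \<mapsto> \<langle>f|g\<rangle>\<close> with
  \<open>f \<in> D\<close>. Expanding \<open>\<langle>f|g\<rangle>\<close> by means of the dual map, \<open>\<mu>\<close>-independence gives
  \<open>\<langle>f|\<theta>\<^sub>x\<rangle> = h x\<close> almost everywhere.\<close>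

section \<open>The strong dual topology\<close>

lemma conj_dual_add:
  assumes "F \<in> conj_dual s T" "G \<in> conj_dual s T"
  shows "F + G \<in> conj_dual s T"
proof -
  have "continuous_map T euclidean (\<lambda>x. F x + G x)"
    using assms by (intro continuous_map_add) (auto simp: conj_dual_def)
  then show ?thesis
    using assms by (auto simp: conj_dual_def conj_linear_on_def plus_fun_def algebra_simps)
qed

lemma conj_dual_scale:
  assumes "F \<in> conj_dual s T"
  shows "fun_scale c F \<in> conj_dual s T"
proof -
  have "continuous_map euclidean euclidean ((*) c)"
    by (simp add: continuous_intros)
  then have "continuous_map T euclidean ((*) c \<circ> F)"
    using assms by (intro continuous_map_compose) (auto simp: conj_dual_def)
  then show ?thesis
    using assms
    by (auto simp: conj_dual_def conj_linear_on_def fun_scale_def o_def algebra_simps)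
qed

lemma dual_seminorm_upper: "g \<in> B \<Longrightarrow> ennreal (cmod (F g)) \<le> dual_seminorm B F"
  unfolding dual_seminorm_def by (rule SUP_upper)

lemma dual_seminorm_add: "dual_seminorm B (F + G) \<le> dual_seminorm B F + dual_seminorm B G"
  unfolding dual_seminorm_def[of B "F + G"]
proof (rule SUP_least)
  fix g assume g: "g \<in> B"
  have "ennreal (cmod ((F + G) g)) \<le> ennreal (cmod (F g)) + ennreal (cmod (G g))"
    by (simp add: norm_triangle_ineq flip: ennreal_plus)
  also have "\<dots> \<le> dual_seminorm B F + dual_seminorm B G"
    using g by (intro add_mono dual_seminorm_upper)
  finally show "ennreal (cmod ((F + G) g)) \<le> dual_seminorm B F + dual_seminorm B G" .
qed

lemma dual_seminorm_minus: "dual_seminorm B (- F) = dual_seminorm B F"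
  by (simp add: dual_seminorm_def)

lemma dual_seminorm_scale:
  "dual_seminorm B (fun_scale c F) = ennreal (cmod c) * dual_seminorm B F"
  by (simp add: dual_seminorm_def fun_scale_def norm_mult ennreal_mult SUP_mult_left_ennreal)

lemma openin_strong_dual_ball:
  assumes "F \<in> conj_dual s T" "tvs_bounded s T B" "0 < e"
  shows "openin (strong_dual_topology s T)
           {G \<in> conj_dual s T. dual_seminorm B (G - F) < ennreal e}"
  unfolding strong_dual_topology_def
  by (rule topology_generated_by_Basis) (use assms in blast)

lemma dual_seminorm_zero: "dual_seminorm B 0 = 0"
  by (simp add: dual_seminorm_def flip: bot_ennreal)

lemma topspace_strong_dual: "topspace (strong_dual_topology s T) = conj_dual s T"
proof
  show "topspace (strong_dual_topology s T) \<subseteq> conj_dual s T"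
    unfolding strong_dual_topology_def topology_generated_by_topspace by blast
  show "conj_dual s T \<subseteq> topspace (strong_dual_topology s T)"
  proof
    fix F assume F: "F \<in> conj_dual s T"
    \<comment> \<open>The empty set is bounded and its seminorm is \<open>0\<close>, since a
      supremum over the empty set in \<open>ennreal\<close> is \<open>0\<close>. This supplies a
      generating ball around \<open>F\<close> whatever the bounded sets of \<open>T\<close>
      are.\<close>
    have "tvs_bounded s T {}"
      by (auto simp: tvs_bounded_def intro: exI[of _ 1])
    from openin_subset[OF openin_strong_dual_ball[OF F this zero_less_one]] F
    show "F \<in> topspace (strong_dual_topology s T)"
      by (auto simp: dual_seminorm_zero)
  qed
qed

text \<open>A 1-Lipschitz bound for a single seminorm suffices: the preimage of a disc of radius
  \<open>e\<close> around \<open>\<Phi> F\<close> contains the seminorm ball of radius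
  \<open>e\<close> around \<open>F\<close>, which is one of the generators of the topology.\<close>

lemma continuous_map_strong_dual:
  assumes B: "tvs_bounded s T B"
    and le: "\<And>F G. F \<in> conj_dual s T \<Longrightarrow> G \<in> conj_dual s T \<Longrightarrow>
               ennreal (cmod (\<Phi> G - \<Phi> F)) \<le> dual_seminorm B (G - F)"
  shows "continuous_map (strong_dual_topology s T) euclidean \<Phi>"
  unfolding continuous_map_def topspace_strong_dual
proof (intro conjI allI impI)
  fix U :: "complex set" assume "openin euclidean U"
  then have U: "open U" by simp
  show "openin (strong_dual_topology s T) {F \<in> conj_dual s T. \<Phi> F \<in> U}"
  proof (subst openin_subopen, rule ballI)
    fix F assume "F \<in> {F \<in> conj_dual s T. \<Phi> F \<in> U}"
    then have F: "F \<in> conj_dual s T" "\<Phi> F \<in> U" by auto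
    obtain e where e: "e > 0" "ball (\<Phi> F) e \<subseteq> U"
      using U F(2) openE by blast
    let ?N = "{G \<in> conj_dual s T. dual_seminorm B (G - F) < ennreal e}"
    have "\<Phi> G \<in> U" if "G \<in> ?N" for G
    proof -
      have "ennreal (cmod (\<Phi> G - \<Phi> F)) < ennreal e"
        using le[OF F(1), of G] that by (auto intro: le_less_trans)
      then show ?thesis
        using e by (auto simp: ennreal_less_iff dist_norm norm_minus_commute)
    qed
    then show "\<exists>N. openin (strong_dual_topology s T) N \<and> F \<in> N \<and>
        N \<subseteq> {F \<in> conj_dual s T. \<Phi> F \<in> U}"
      using openin_strong_dual_ball[OF F(1) B e(1)] F(1) e(1)
      by (intro exI[of _ ?N]) (auto simp: dual_seminorm_zero)
  qed
qed auto

text \<open>Extension by continuity of a seminorm-dominated functional from a dense image. It is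
  applied with \<open>p\<close> the strong dual seminorm of a bounded set, \<open>j\<close> the
  embedding of \<open>D\<close> and \<open>W\<close> the conjugate dual. Domination makes
  \<open>L\<close> Lipschitz along \<open>j\<close>, so its values at approximants of
  \<open>F\<close> converge in the complex plane. Values in \<open>ennreal\<close> let the laws of
  \<open>p\<close> hold on the whole type, where the seminorm may be infinite.\<close>

lemma conj_linear_extension:
  fixes p :: "'w::ab_group_add \<Rightarrow> ennreal" and j :: "'d::ab_group_add \<Rightarrow> 'w"
    and L :: "'d \<Rightarrow> complex" and D :: "'d set"
  assumes p_add: "\<And>x y. p (x + y) \<le> p x + p y"
    and p_minus: "\<And>x. p (- x) = p x"
    and p_zero: "p 0 = 0"
    and p_scale: "\<And>c x. p (sw c x) = ennreal (cmod c) * p x"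
    and sw_diff: "\<And>c x y. sw c (x - y) = sw c x - sw c y"
    and D_add: "\<And>x y. x \<in> D \<Longrightarrow> y \<in> D \<Longrightarrow> x + y \<in> D"
    and D_diff: "\<And>x y. x \<in> D \<Longrightarrow> y \<in> D \<Longrightarrow> x - y \<in> D"
    and D_scale: "\<And>c x. x \<in> D \<Longrightarrow> sd c x \<in> D"
    and j_add: "\<And>x y. x \<in> D \<Longrightarrow> y \<in> D \<Longrightarrow> j (x + y) = j x + j y"
    and j_scale: "\<And>c x. x \<in> D \<Longrightarrow> j (sd c x) = sw c (j x)"
    and L: "conj_linear_on sd D L"
    and bound: "\<And>g. g \<in> D \<Longrightarrow> ennreal (cmod (L g)) \<le> p (j g)"
    and W_add: "\<And>x y. x \<in> W \<Longrightarrow> y \<in> W \<Longrightarrow> x + y \<in> W"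
    and W_scale: "\<And>c x. x \<in> W \<Longrightarrow> sw c x \<in> W"
    and jW: "\<And>g. g \<in> D \<Longrightarrow> j g \<in> W"
    and dense: "\<And>F e. F \<in> W \<Longrightarrow> 0 < e \<Longrightarrow> \<exists>g\<in>D. p (F - j g) < ennreal e"
  obtains \<Phi> where "conj_linear_on sw W \<Phi>"
    and "\<And>F G. F \<in> W \<Longrightarrow> G \<in> W \<Longrightarrow> ennreal (cmod (\<Phi> G - \<Phi> F)) \<le> p (G - F)"
    and "\<And>g. g \<in> D \<Longrightarrow> \<Phi> (j g) = L g"
proof -
  \<comment> \<open>\<open>R\<close> is the closure of the graph of
    \<open>j g \<mapsto> L g\<close>; one and the same \<open>g\<close> has to approximate both
    coordinates. Conjugate linearity is proved for this relation first, so no sequences have to be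
    combined, and \<open>R\<close> is then shown to be a function on \<open>W\<close>.\<close>
  define R where "R F z \<longleftrightarrow> (\<forall>e>0. \<exists>g\<in>D. p (F - j g) < ennreal e \<and> cmod (z - L g) < e)"
    for F z
  have j_diff: "j (x - y) = j x - j y" if "x \<in> D" "y \<in> D" for x y
    using j_add[of "x - y" y] D_diff[of x y] that by (simp add: algebra_simps)
  have L_add: "L (x + y) = L x + L y" if "x \<in> D" "y \<in> D" for x y
    using L that by (auto simp: conj_linear_on_def)
  have L_scale: "L (sd c x) = cnj c * L x" if "x \<in> D" for c x
    using L that by (auto simp: conj_linear_on_def)
  have L_diff: "L (x - y) = L x - L y" if "x \<in> D" "y \<in> D" for x y
    using L_add[of "x - y" y] D_diff[of x y] that by (simp add: algebra_simps)
  have p_diff_comm: "p (x - y) = p (y - x)" for x y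
    using p_minus[of "x - y"] by simp
  have L_lip: "ennreal (cmod (L x - L y)) \<le> p (j x - j y)" if "x \<in> D" "y \<in> D" for x y
    using bound[OF D_diff, of x y] that by (simp add: L_diff j_diff)
  have R_add: "R (F + G) (z + w)" if F: "R F z" and G: "R G w" for F G z w
    unfolding R_def
  proof (intro allI impI)
    fix e :: real assume e: "e > 0"
    obtain x where x: "x \<in> D" "p (F - j x) < ennreal (e/2)" "cmod (z - L x) < e/2"
      using F e unfolding R_def by (meson half_gt_zero)
    obtain y where y: "y \<in> D" "p (G - j y) < ennreal (e/2)" "cmod (w - L y) < e/2"
      using G e unfolding R_def by (meson half_gt_zero)
    have "p (F + G - j (x + y)) = p ((F - j x) + (G - j y))"
      using x y by (simp add: j_add algebra_simps)
    also have "\<dots> \<le> p (F - j x) + p (G - j y)"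
      by (rule p_add)
    also have "\<dots> < ennreal (e/2) + ennreal (e/2)"
      using x y by (intro add_strict_mono)
    also have "\<dots> = ennreal e"
      using e by (simp flip: ennreal_plus)
    finally have "p (F + G - j (x + y)) < ennreal e" .
    moreover have "cmod (z + w - L (x + y)) < e"
    proof -
      have "z + w - L (x + y) = (z - L x) + (w - L y)"
        using x y by (simp add: L_add)
      then have "cmod (z + w - L (x + y)) \<le> cmod (z - L x) + cmod (w - L y)"
        by (simp only: norm_triangle_ineq)
      then show ?thesis
        using x y by linarith
    qed
    ultimately show "\<exists>g\<in>D. p (F + G - j g) < ennreal e \<and> cmod (z + w - L g) < e"
      using D_add x y by blast
  qed
  have R_scale: "R (sw c F) (cnj c * z)" if F: "R F z" for F z c
    unfolding R_def
  proof (intro allI impI)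
    fix e :: real assume e: "e > 0"
    \<comment> \<open>Adding \<open>1\<close> keeps \<open>k\<close> positive for
      \<open>c = 0\<close> and makes \<open>cmod c / k\<close> less than \<open>1\<close>, so the
      scaled error stays strictly below \<open>e\<close>.\<close>
    define k where "k = cmod c + 1"
    have k: "k > 0" by (simp add: k_def add_nonneg_pos)
    obtain x where x: "x \<in> D" "p (F - j x) < ennreal (e/k)" "cmod (z - L x) < e/k"
      using F e k unfolding R_def by (meson divide_pos_pos)
    have c_e: "cmod c * (e/k) < e"
      using e k by (simp add: k_def field_simps)
    have "p (sw c F - j (sd c x)) = ennreal (cmod c) * p (F - j x)"
      using x by (simp add: j_scale p_scale flip: sw_diff)
    also have "\<dots> \<le> ennreal (cmod c) * ennreal (e/k)"
      using x by (intro mult_left_mono) auto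
    also have "\<dots> = ennreal (cmod c * (e/k))"
      using e k by (intro ennreal_mult[symmetric]) auto
    also have "\<dots> < ennreal e"
      using c_e e by (intro ennreal_lessI)
    finally have "p (sw c F - j (sd c x)) < ennreal e" .
    moreover have "cmod (cnj c * z - L (sd c x)) < e"
    proof -
      have "cmod (cnj c * z - L (sd c x)) = cmod c * cmod (z - L x)"
        using x by (simp add: L_scale norm_mult flip: right_diff_distrib)
      also have "\<dots> \<le> cmod c * (e/k)"
        using x by (intro mult_left_mono) auto
      finally show ?thesis using c_e by simp
    qed
    ultimately show "\<exists>g\<in>D. p (sw c F - j g) < ennreal e \<and> cmod (cnj c * z - L g) < e"
      using D_scale x by blast
  qed
  \<comment> \<open>This estimate serves twice: with \<open>F = G\<close> it makes \<open>z\<close>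
    unique, and for arbitrary \<open>F\<close> and \<open>G\<close> it is the Lipschitz bound of the
    conclusion. Two errors of \<open>e/4\<close> arise among the values and two more in the
    seminorm, \<open>e\<close> altogether.\<close>
  have R_lip: "ennreal (cmod (w - z)) \<le> p (G - F)" if F: "R F z" and G: "R G w" for F G z w
  proof (rule ennreal_le_epsilon)
    fix e :: real assume e: "e > 0"
    obtain x where x: "x \<in> D" "p (F - j x) < ennreal (e/4)" "cmod (z - L x) < e/4"
      using F e unfolding R_def by (metis divide_pos_pos zero_less_numeral)
    obtain y where y: "y \<in> D" "p (G - j y) < ennreal (e/4)" "cmod (w - L y) < e/4"
      using G e unfolding R_def by (metis divide_pos_pos zero_less_numeral)
    have "cmod (w - z) \<le> cmod (w - L y) + cmod (z - L x) + cmod (L y - L x)"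
    proof -
      have "w - z = (w - L y) - (z - L x) + (L y - L x)" by simp
      then have "cmod (w - z) \<le> cmod ((w - L y) - (z - L x)) + cmod (L y - L x)"
        by (simp only: norm_triangle_ineq)
      then show ?thesis
        using norm_triangle_ineq4[of "w - L y" "z - L x"] by linarith
    qed
    also have "\<dots> \<le> e/2 + cmod (L y - L x)"
      using x y by simp
    finally have "ennreal (cmod (w - z)) \<le> ennreal (e/2 + cmod (L y - L x))"
      by (rule ennreal_leI)
    also have "\<dots> = ennreal (e/2) + ennreal (cmod (L y - L x))"
      using e by (intro ennreal_plus) auto
    also have "ennreal (cmod (L y - L x)) \<le> p (j y - j x)"
      using x y by (intro L_lip)
    also have "p (j y - j x) = p ((G - F) + ((F - j x) + (j y - G)))"
      by simp
    also have "\<dots> \<le> p (G - F) + (p (F - j x) + p (j y - G))"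
      by (meson add_left_mono order_trans p_add)
    also have "\<dots> \<le> p (G - F) + (ennreal (e/4) + ennreal (e/4))"
      using x y by (intro add_mono) (auto simp: p_diff_comm)
    also have "ennreal (e/4) + ennreal (e/4) = ennreal (e/2)"
      using e by (simp flip: ennreal_plus)
    also have "ennreal (e/2) + (p (G - F) + ennreal (e/2)) = p (G - F) + ennreal e"
    proof -
      have "ennreal e = ennreal (e/2) + ennreal (e/2)"
        using e by (simp flip: ennreal_plus)
      then show ?thesis by (simp add: ac_simps)
    qed
    finally show "ennreal (cmod (w - z)) \<le> p (G - F) + ennreal e"
      by (simp add: add_left_mono)
  qed
  have R_j: "R (j g) (L g)" if "g \<in> D" for g
    using that p_zero unfolding R_def by (auto intro!: bexI[of _ g])
  have R_ex: "\<exists>z. R F z" if F: "F \<in> W" for F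
  proof -
    \<comment> \<open>Passing through \<open>F\<close> in the triangle inequality makes the images
      of the \<open>g n\<close> Cauchy for \<open>p\<close>. By \<open>L_lip\<close> the numbers
      \<open>L (g n)\<close> are then Cauchy, and completeness of the complex numbers provides the
      value at \<open>F\<close>.\<close>
    have "\<exists>g. \<forall>n. g n \<in> D \<and> p (F - j (g n)) < ennreal (1 / Suc n)"
      using dense[OF F] by (intro choice) (simp add: Bex_def)
    then obtain g where g: "\<And>n. g n \<in> D" "\<And>n. p (F - j (g n)) < ennreal (1 / Suc n)"
      by auto
    have g_diff: "cmod (L (g m) - L (g n)) < 1 / Suc m + 1 / Suc n" for m n
    proof -
      have "ennreal (cmod (L (g m) - L (g n))) \<le> p (j (g m) - j (g n))"
        using g by (intro L_lip)
      also have "\<dots> = p ((j (g m) - F) + (F - j (g n)))" by simp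
      also have "\<dots> \<le> p (j (g m) - F) + p (F - j (g n))" by (rule p_add)
      also have "\<dots> < ennreal (1 / Suc m) + ennreal (1 / Suc n)"
        using g by (intro add_strict_mono) (auto simp: p_diff_comm[of _ F])
      also have "\<dots> = ennreal (1 / Suc m + 1 / Suc n)"
        by (intro ennreal_plus[symmetric]) auto
      finally show ?thesis
        by (subst (asm) ennreal_less_iff) auto
    qed
    have small: "1 / real (Suc n) < e" if "inverse (real (Suc N)) < e" "n \<ge> N" for n N e
    proof -
      have "1 / real (Suc n) \<le> inverse (real (Suc N))"
        using that by (simp add: field_simps)
      then show ?thesis
        using that by linarith
    qed
    have "Cauchy (\<lambda>n. L (g n))"
    proof (rule CauchyI)
      fix e :: real assume "e > 0"
      then obtain N where N: "inverse (real (Suc N)) < e/2"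
        using reals_Archimedean[of "e/2"] by auto
      show "\<exists>N. \<forall>m\<ge>N. \<forall>n\<ge>N. cmod (L (g m) - L (g n)) < e"
      proof (intro exI[of _ N] allI impI)
        fix m n assume "N \<le> m" "N \<le> n"
        then show "cmod (L (g m) - L (g n)) < e"
          using g_diff[of m n] small[OF N, of m] small[OF N, of n] by linarith
      qed
    qed
    then obtain z where z: "(\<lambda>n. L (g n)) \<longlonglongrightarrow> z"
      using Cauchy_convergent convergent_def by blast
    have "R F z" unfolding R_def
    proof (intro allI impI)
      fix e :: real assume e: "e > 0"
      obtain N1 where N1: "\<And>n. n \<ge> N1 \<Longrightarrow> cmod (L (g n) - z) < e"
        using z e by (meson LIMSEQ_D)
      obtain N2 where N2: "inverse (real (Suc N2)) < e"
        using reals_Archimedean[OF e] by auto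
      \<comment> \<open>One index past both thresholds, because \<open>R\<close> requires a common
        witness for the two approximations.\<close>
      let ?n = "max N1 N2"
      have "p (F - j (g ?n)) < ennreal (1 / Suc ?n)" by (rule g)
      also have "\<dots> < ennreal e"
        using small[OF N2, of ?n] e by (intro ennreal_lessI) auto
      finally show "\<exists>g\<in>D. p (F - j g) < ennreal e \<and> cmod (z - L g) < e"
        using g(1)[of ?n] N1[of ?n] by (auto simp: norm_minus_commute)
    qed
    then show ?thesis ..
  qed
  have R_unique: "z = w" if "R F z" "R F w" for F z w
    using R_lip[OF that] p_zero by simp
  \<comment> \<open>On \<open>W\<close> the choice is forced by \<open>R_ex\<close> and
    \<open>R_unique\<close>, so each property of \<open>\<Phi>\<close> follows by exhibiting a value
    related by \<open>R\<close>.\<close>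
  define \<Phi> where "\<Phi> F = (SOME z. R F z)" for F
  have \<Phi>: "R F (\<Phi> F)" if "F \<in> W" for F
    unfolding \<Phi>_def using R_ex[OF that] by (rule someI_ex)
  show thesis
  proof
    show "conj_linear_on sw W \<Phi>"
      unfolding conj_linear_on_def
    proof (intro conjI ballI allI)
      show "\<Phi> (x + y) = \<Phi> x + \<Phi> y" if "x \<in> W" "y \<in> W" for x y
        using that by (intro R_unique[of "x + y"] R_add \<Phi> W_add)
      show "\<Phi> (sw c x) = cnj c * \<Phi> x" if "x \<in> W" for c x
        using that by (intro R_unique[of "sw c x"] R_scale \<Phi> W_scale)
    qed
    show "ennreal (cmod (\<Phi> G - \<Phi> F)) \<le> p (G - F)" if "F \<in> W" "G \<in> W" for F G
      using that by (intro R_lip \<Phi>)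
    show "\<Phi> (j g) = L g" if "g \<in> D" for g
      using that by (intro R_unique[of "j g"] \<Phi> R_j jW)
  qed
qed

section \<open>Rigged Hilbert spaces\<close>

context rigged_hilbert_space
begin

lemma hilbert_to_dual_mem: "hilbert_to_dual cinner D h \<in> conj_dual scaleC t"
  using continuous_map_image_subset_topspace[OF hilbert_to_dual_continuous]
  by (auto simp: topspace_strong_dual)

lemma subspace_D: "module.subspace scaleC D"
  using locally_convex_t by (simp add: locally_convex_tvs_def topspace_t)

text \<open>The rigging provides density of the whole Hilbert space in the dual. The preimage
  \<open>V\<close> of a seminorm ball is therefore nonempty, and it is norm open because the
  embedding is continuous; norm density of \<open>D\<close> then puts a point of \<open>D\<close>
  into it.\<close>

lemma D_dense_in_dual:
  assumes F: "F \<in> conj_dual scaleC t" and B: "tvs_bounded scaleC t B" and e: "0 < e"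
  shows "\<exists>g\<in>D. dual_seminorm B (F - hilbert_to_dual cinner D g) < ennreal e"
proof -
  define N where "N = {G \<in> conj_dual scaleC t. dual_seminorm B (G - F) < ennreal e}"
  define V where "V = {h. hilbert_to_dual cinner D h \<in> N}"
  have N: "openin (strong_dual_topology scaleC t) N"
    unfolding N_def by (rule openin_strong_dual_ball[OF F B e])
  have "F \<in> N"
    using F e by (simp add: N_def dual_seminorm_zero)
  moreover have "F \<in> strong_dual_topology scaleC t closure_of range (hilbert_to_dual cinner D)"
    using F by (simp add: hilbert_to_dual_dense)
  ultimately have "V \<noteq> {}"
    using N unfolding in_closure_of V_def by blast
  moreover have "open V"
    using openin_continuous_map_preimage[OF hilbert_to_dual_continuous N] by (simp add: V_def)
  ultimately have "V \<inter> D \<noteq> {}"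
    using open_Int_closure_eq_empty[of V D] by (simp add: D_dense)
  then obtain g where g: "g \<in> D" "hilbert_to_dual cinner D g \<in> N"
    by (auto simp: V_def)
  have "dual_seminorm B (F - hilbert_to_dual cinner D g)
          = dual_seminorm B (hilbert_to_dual cinner D g - F)"
    using dual_seminorm_minus[of B "F - hilbert_to_dual cinner D g"] by simp
  then show ?thesis
    using g by (intro bexI[of _ g]) (simp_all add: N_def)
qed

text \<open>This is where reflexivity enters: the extension of \<open>L\<close> to the conjugate
  dual belongs to the bidual, hence is evaluation at some \<open>f\<close> in \<open>D\<close> by
  surjectivity of the canonical map.\<close>

lemma dominated_functional_representation:
  assumes refl: "reflexive_tvs scaleC t"
    and L: "conj_linear_on scaleC D L"
    and B: "tvs_bounded scaleC t B"
    and bound: "\<And>g. g \<in> D \<Longrightarrow> ennreal (cmod (L g)) \<le> (SUP f\<in>B. ennreal (cmod (cinner f g)))"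
  obtains f where "f \<in> D" and "\<And>g. g \<in> D \<Longrightarrow> L g = cinner f g"
proof -
  let ?j = "hilbert_to_dual cinner D" and ?W = "conj_dual scaleC t"
  have BD: "B \<subseteq> D"
    using B by (simp add: tvs_bounded_def topspace_t)
  \<comment> \<open>Conjugate symmetry leaves the modulus unchanged, so the bound in the hypothesis
    is exactly the strong dual seminorm of the embedded \<open>g\<close>. The inclusion of
    \<open>B\<close> in \<open>D\<close> matters because embedded vectors are set to
    \<open>0\<close> outside \<open>D\<close>.\<close>
  have seminorm_j: "(SUP f\<in>B. ennreal (cmod (cinner f g))) = dual_seminorm B (?j g)" for g
    unfolding dual_seminorm_def
  proof (rule SUP_cong)
    fix f assume "f \<in> B"
    then show "ennreal (cmod (cinner f g)) = ennreal (cmod (?j g f))"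
      using BD cinner_commute[of f g] by (auto simp: hilbert_to_dual_def)
  qed simp
  have j_add: "?j (x + y) = ?j x + ?j y" for x y
    by (auto simp: hilbert_to_dual_def cinner_add_left)
  have j_scale: "?j (scaleC c x) = fun_scale c (?j x)" for c x
    by (auto simp: hilbert_to_dual_def fun_scale_def cinner_scaleC_left)
  obtain \<Phi> where \<Phi>: "conj_linear_on fun_scale ?W \<Phi>"
    and lip: "\<And>F G. F \<in> ?W \<Longrightarrow> G \<in> ?W \<Longrightarrow>
                ennreal (cmod (\<Phi> G - \<Phi> F)) \<le> dual_seminorm B (G - F)"
    and \<Phi>_j: "\<And>g. g \<in> D \<Longrightarrow> \<Phi> (?j g) = L g"
  proof (rule conj_linear_extension[where p = "dual_seminorm B" and W = ?W and D = D and j = ?j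
          and L = L and sd = scaleC and sw = fun_scale])
    show "fun_scale c (F - G) = fun_scale c F - fun_scale c G" for c and F G :: "'h \<Rightarrow> complex"
      by (auto simp: fun_scale_def right_diff_distrib)
    show "ennreal (cmod (L g)) \<le> dual_seminorm B (?j g)" if "g \<in> D" for g
      using bound[OF that] by (simp add: seminorm_j)
  qed (use subspace_D subspace_add subspace_diff subspace_scale D_dense_in_dual[OF _ B]
        in \<open>auto simp: dual_seminorm_add dual_seminorm_minus dual_seminorm_zero dual_seminorm_scale
              j_add j_scale L conj_dual_add conj_dual_scale hilbert_to_dual_mem\<close>)
  \<comment> \<open>Members of \<open>conj_dual\<close> vanish outside the underlying space by
    convention, hence the cut-off.\<close>
  define \<Psi> where "\<Psi> F = (if F \<in> ?W then \<Phi> F else 0)" for F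
  have "conj_linear_on fun_scale ?W \<Psi>"
    using \<Phi> by (simp add: conj_linear_on_def \<Psi>_def conj_dual_add conj_dual_scale)
  moreover have "continuous_map (strong_dual_topology scaleC t) euclidean \<Psi>"
    by (rule continuous_map_strong_dual[OF B]) (simp add: \<Psi>_def lip)
  ultimately have "\<Psi> \<in> conj_dual fun_scale (strong_dual_topology scaleC t)"
    by (simp add: conj_dual_def[of fun_scale] topspace_strong_dual \<Psi>_def)
  also have "\<dots> = canonical_bidual_map scaleC t ` D"
    using homeomorphic_imp_surjective_map[OF refl[unfolded reflexive_tvs_def]]
    by (simp add: topspace_strong_dual topspace_t)
  finally obtain f where f: "f \<in> D" "\<Psi> = canonical_bidual_map scaleC t f"
    by blast
  show thesis
  proof
    show "f \<in> D" by (rule f)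
    fix g assume g: "g \<in> D"
    \<comment> \<open>Evaluation at the embedded \<open>g\<close> conjugates
      \<open>cinner g f\<close>, and conjugate symmetry turns this into
      \<open>cinner f g\<close>.\<close>
    have "L g = \<Psi> (?j g)"
      using g by (simp add: \<Psi>_def hilbert_to_dual_mem \<Phi>_j)
    also have "\<dots> = cnj (cinner g f)"
      using f hilbert_to_dual_mem by (simp add: canonical_bidual_map_def hilbert_to_dual_def)
    also have "\<dots> = cinner f g"
      by (rule cinner_commute[symmetric])
    finally show "L g = cinner f g" .
  qed
qed

end

section \<open>Square integrable functions and the Riesz-Fischer property\<close>

lemma square_integrable_mult_integrable:
  fixes h u :: "'x \<Rightarrow> complex"
  assumes "h \<in> square_integrable M" "u \<in> square_integrable M"
  shows "integrable M (\<lambda>x. h x * u x)"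
proof (rule Bochner_Integration.integrable_bound)
  show "integrable M (\<lambda>x. (cmod (h x))\<^sup>2 + (cmod (u x))\<^sup>2)"
    using assms by (simp add: square_integrable_def)
  show "(\<lambda>x. h x * u x) \<in> borel_measurable M"
    using assms by (auto simp: square_integrable_def)
  have "a * b \<le> a\<^sup>2 + b\<^sup>2" if "a \<ge> 0" "b \<ge> 0" for a b :: real
    using sum_squares_bound[of a b] mult_nonneg_nonneg[OF that] by linarith
  then show "AE x in M. norm (h x * u x) \<le> norm ((cmod (h x))\<^sup>2 + (cmod (u x))\<^sup>2)"
    by (simp add: norm_mult)
qed

lemma bessel_map_square_integrable:
  assumes "bessel_map s t M \<omega>" "g \<in> topspace t"
  shows "(\<lambda>x. \<omega> x g) \<in> square_integrable M"
proof -
  have "(\<lambda>x. cnj (\<omega> x g)) \<in> borel_measurable M"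
    using assms by (simp add: bessel_map_def weakly_measurable_map_def)
  \<comment> \<open>Weak measurability concerns the conjugated value; a second conjugation recovers
    \<open>\<omega> x g\<close>.\<close>
  then have "(\<lambda>x. cnj (cnj (\<omega> x g))) \<in> borel_measurable M"
    by (rule borel_measurable_continuous_on[OF continuous_on_cnj[OF continuous_on_id]])
  moreover have "(\<integral>\<^sup>+ x. ennreal ((cmod (\<omega> x g))\<^sup>2) \<partial>M) < \<infinity>"
    using assms by (simp add: bessel_map_def)
  ultimately show ?thesis
    by (auto simp: square_integrable_def integrable_iff_bounded)
qed

theorem proposition3p11:
  fixes scaleC :: "complex \<Rightarrow> 'h::banach \<Rightarrow> 'h"
    and cinner :: "'h \<Rightarrow> 'h \<Rightarrow> complex"
    and D :: "'h set" and t :: "'h topology"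
    and M :: "'x measure"
    and \<omega> \<theta> :: "'x \<Rightarrow> 'h \<Rightarrow> complex"
  assumes "rigged_hilbert_space scaleC cinner D t"
    and "reflexive_tvs scaleC t"
    and "sigma_finite_measure M"
    and "mu_independent_map scaleC t M \<omega>"
    and "bessel_map scaleC t M \<omega>"
    and "\<And>h. h \<in> square_integrable M \<Longrightarrow>
           \<exists>B. tvs_bounded scaleC t B \<and>
               (\<forall>g\<in>D. ennreal (cmod (LINT x|M. h x * \<omega> x g))
                        \<le> (SUP f\<in>B. ennreal (cmod (cinner f g))))"
    and "dual_map scaleC cinner t M \<omega> \<theta>"
  shows "riesz_fischer_map scaleC t M \<theta>"
proof -
  interpret rigged_hilbert_space scaleC cinner D t by fact
  have \<theta>: "weakly_measurable_map scaleC t M \<theta>"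
    using assms(7) by (simp add: dual_map_def)
  have \<omega>_dual: "\<omega> x \<in> conj_dual scaleC t" if "x \<in> space M" for x
    using assms(5) that by (auto simp: bessel_map_def weakly_measurable_map_def)
  have "\<exists>f\<in>D. AE x in M. cnj (\<theta> x f) = h x" if h: "h \<in> square_integrable M" for h
  proof -
    define L where "L g = (LINT x|M. h x * \<omega> x g)" for g
    have int: "integrable M (\<lambda>x. h x * \<omega> x g)" if "g \<in> D" for g
      using square_integrable_mult_integrable[OF h] bessel_map_square_integrable[OF assms(5)] that
      by (simp add: topspace_t)
    have "conj_linear_on scaleC D L"
      unfolding conj_linear_on_def
    proof (intro conjI ballI allI)
      fix x y assume xy: "x \<in> D" "y \<in> D"
      \<comment> \<open>Conjugate linearity of \<open>\<omega> a\<close> is known for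
        \<open>a\<close> in \<open>space M\<close>, which is all that congruence of integrals asks
        for.\<close>
      have "L (x + y) = (LINT a|M. h a * \<omega> a x + h a * \<omega> a y)"
        unfolding L_def using \<omega>_dual xy
        by (intro Bochner_Integration.integral_cong)
           (auto simp: conj_dual_def conj_linear_on_def topspace_t algebra_simps)
      then show "L (x + y) = L x + L y"
        using int xy by (simp add: L_def)
    next
      fix c x assume x: "x \<in> D"
      have "L (scaleC c x) = (LINT a|M. cnj c * (h a * \<omega> a x))"
        unfolding L_def using \<omega>_dual x
        by (intro Bochner_Integration.integral_cong)
           (auto simp: conj_dual_def conj_linear_on_def topspace_t)
      then show "L (scaleC c x) = cnj c * L x"
        by (simp add: L_def)
    qed
    then obtain f where f: "f \<in> D" "\<And>g. g \<in> D \<Longrightarrow> L g = cinner f g"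
      using assms(6)[OF h] dominated_functional_representation[OF assms(2), of L]
      unfolding L_def by blast
    \<comment> \<open>\<open>\<mu>\<close>-independence tests against
      \<open>cnj (\<omega> x g)\<close>, whereas \<open>L\<close> and the dual map integrate against
      \<open>\<omega> x g\<close>; conjugating the difference reconciles the two.\<close>
    define \<xi> where "\<xi> x = cnj (h x - cnj (\<theta> x f))" for x
    have \<xi>_meas: "\<xi> \<in> borel_measurable M"
    proof -
      have "(\<lambda>x. h x - cnj (\<theta> x f)) \<in> borel_measurable M"
        using h \<theta> f(1)
        by (intro borel_measurable_diff)
           (auto simp: square_integrable_def weakly_measurable_map_def topspace_t)
      then show ?thesis
        unfolding \<xi>_def by (intro borel_measurable_continuous_on[of cnj] continuous_intros)
    qed
    have "has_bochner_integral M (\<lambda>x. \<xi> x * cnj (\<omega> x g)) 0" if g: "g \<in> D" for g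
    proof -
      have \<theta>_int: "integrable M (\<lambda>x. cnj (\<theta> x f) * \<omega> x g)"
        "cinner f g = (LINT x|M. cnj (\<theta> x f) * \<omega> x g)"
        using assms(7) f(1) g by (auto simp: dual_map_def topspace_t)
      \<comment> \<open>Both terms are integrable, so the integral of the difference exists, and its
        value \<open>L g - cinner f g\<close> is \<open>0\<close> by the choice of
        \<open>f\<close>.\<close>
      have "has_bochner_integral M (\<lambda>x. h x * \<omega> x g - cnj (\<theta> x f) * \<omega> x g)
              (L g - cinner f g)"
        unfolding L_def \<theta>_int(2)
        by (intro has_bochner_integral_diff has_bochner_integral_integrable int g \<theta>_int)
      from has_bochner_integral_cnj[OF this] show ?thesis
        using f(2)[OF g] by (simp add: \<xi>_def algebra_simps)
    qed
    then have "AE x in M. \<xi> x = 0"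
      using assms(4) \<xi>_meas by (simp add: mu_independent_map_def topspace_t)
    then have "AE x in M. cnj (\<theta> x f) = h x"
      by eventually_elim (simp only: \<xi>_def complex_cnj_zero_iff right_minus_eq)
    with f(1) show ?thesis by blast
  qed
  then show ?thesis
    using \<theta> by (simp add: riesz_fischer_map_def topspace_t)
qed

end
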